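(* Let $b\in\mathbb{C}$ be non-zero and let $\mathbb{K}$ be the $\mathbb{C}$-algebra of hybrid numbers, with the weak Hopf algebra structure (depending on $b$) described in the context. Then the target algebra $\varepsilon_t(\mathbb{K})$ and the source algebra $\varepsilon_s(\mathbb{K})$ coincide, and $$\varepsilon_t(\mathbb{K})=\varepsilon_s(\mathbb{K})=\mathbb{C}\langle 1,\ \nu-i\mu\rangle,$$ the $\mathbb{C}$-linear span of $1$ and $\nu-i\mu$.
   Context: All vector spaces, linear maps and tensor products are over $\mathbb{C}$; $i$ is the imaginary unit. Hybrid numbers: $\mathbb{K}$ is the 4-dimensional associative unital $\mathbb{C}$-algebra with basis $1,g,\mu,\nu$ (unit $1$) and multiplication $g^2=-1$, $\mu^2=0$, $\nu^2=1$, $g\mu=1-\nu$, $\mu g=1+\nu$, $g\nu=\mu+g$, $\nu g=-\mu-g$, $\mu\nu=-\mu$, $\nu\mu=\mu$. Weak Hopf algebra structure on $\mathbb{K}$ (all maps linear): $\Delta(1)=\tfrac12\, 1\otimes 1-\tfrac12\,\mu\otimes\mu-\tfrac i2\,\nu\otimes\mu-\tfrac i2\,\mu\otimes\nu+\tfrac12\,\nu\otimes\nu$; $\Delta(g)=-\tfrac12\,\mu\otimes 1-\tfrac i2\,\nu\otimes 1+b\,g\otimes g+b\,\mu\otimes g+ib\,\nu\otimes g-\tfrac12\,1\otimes\mu+b\,g\otimes\mu+b\,\mu\otimes\mu+ib\,\nu\otimes\mu-\tfrac i2\,1\otimes\nu+ib\,g\otimes\nu+ib\,\mu\otimes\nu-b\,\nu\otimes\nu$;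 $\Delta(\mu)=\tfrac1{2b}\,\mu\otimes\mu$; $\Delta(\nu)=-\tfrac i2\,\mu\otimes 1+\tfrac12\,\nu\otimes 1-\tfrac i2\,1\otimes\mu+\tfrac i{2b}\,\mu\otimes\mu+\tfrac12\,1\otimes\nu$; $\varepsilon(1)=2$, $\varepsilon(g)=\tfrac1b$, $\varepsilon(\mu)=2b$, $\varepsilon(\nu)=2ib$; antipode $S(1)=1$, $S(g)=(-1+\tfrac1{2b^2})\mu-i\nu$, $S(\mu)=2b^2g+2b^2\mu+2ib^2\nu$, $S(\nu)=2ib^2g-(i-2ib^2)\mu+(1-2b^2)\nu$. With $\Delta(1)=1_{(1)}\otimes 1_{(2)}$ (Sweedler notation, summation omitted), the maps $\varepsilon_t,\varepsilon_s:\mathbb{K}\to\mathbb{K}$ are $\varepsilon_t(h)=\varepsilon(1_{(1)}h)1_{(2)}$ and $\varepsilon_s(h)=\varepsilon(h1_{(2)})1_{(1)}$. The target algebra is the image $\varepsilon_t(\mathbb{K})$ and the source algebra is the image $\varepsilon_s(\mathbb{K})$. *)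

theory Defs
  imports "HOL-Analysis.Analysis"
begin

section \<open>The algebra of hybrid numbers\<close>

datatype hbasis = BOne | BG | BMu | BNu

lemma UNIV_hbasis: "UNIV = {BOne, BG, BMu, BNu}"
  using hbasis.exhaust by auto

instance hbasis :: finite
  by standard (simp add: UNIV_hbasis)

lemma sum_hbasis: "(\<Sum>i\<in>UNIV. f i) = f BOne + f BG + f BMu + f BNu"
  for f :: "hbasis \<Rightarrow> 'a::comm_monoid_add"
  by (simp add: UNIV_hbasis add.assoc)

lemma all_hbasis: "(\<forall>i. P i) \<longleftrightarrow> P BOne \<and> P BG \<and> P BMu \<and> P BNu"
  using hbasis.nchotomy by (auto intro: hbasis.induct)

text \<open>An element is its family of coordinates with respect to the basis \<open>1, g, \<mu>, \<nu>\<close>.\<close>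

typedef hybrid = "UNIV :: (hbasis \<Rightarrow> complex) set"
  morphisms hcoord Hybrid by simp

setup_lifting type_definition_hybrid

lemma hybrid_eq_iff: "x = y \<longleftrightarrow> (\<forall>i. hcoord x i = hcoord y i)"
  by transfer auto

instantiation hybrid :: ab_group_add
begin

lift_definition zero_hybrid :: hybrid is "\<lambda>i. 0" .
lift_definition plus_hybrid :: "hybrid \<Rightarrow> hybrid \<Rightarrow> hybrid" is "\<lambda>x y i. x i + y i" .
lift_definition uminus_hybrid :: "hybrid \<Rightarrow> hybrid" is "\<lambda>x i. - x i" .
lift_definition minus_hybrid :: "hybrid \<Rightarrow> hybrid \<Rightarrow> hybrid" is "\<lambda>x y i. x i - y i" .

instance
  by standard (transfer, auto simp: fun_eq_iff algebra_simps)+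

end

lift_definition hscale :: "complex \<Rightarrow> hybrid \<Rightarrow> hybrid"  (infixr \<open>*\<^sub>K\<close> 75)
  is "\<lambda>c x i. c * x i" .

lift_definition hbvec :: "hbasis \<Rightarrow> hybrid" is "\<lambda>i j. if j = i then 1 else 0" .

lemma hcoord_simps [simp]:
  "hcoord 0 i = 0"
  "hcoord (x + y) i = hcoord x i + hcoord y i"
  "hcoord (- x) i = - hcoord x i"
  "hcoord (x - y) i = hcoord x i - hcoord y i"
  "hcoord (c *\<^sub>K x) i = c * hcoord x i"
  "hcoord (hbvec k) i = (if i = k then 1 else 0)"
  by (transfer; simp)+

lemma hcoord_sum [simp]: "hcoord (sum f A) i = (\<Sum>a\<in>A. hcoord (f a) i)"
  by (induction A rule: infinite_finite_induct) auto

global_interpretation hybrid: vector_space hscale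
  by unfold_locales (auto simp: hybrid_eq_iff algebra_simps)

lemma hybrid_expansion: "x = (\<Sum>i\<in>UNIV. hcoord x i *\<^sub>K hbvec i)"
  unfolding hybrid_eq_iff all_hbasis by (simp add: sum_hbasis)

abbreviation hg :: hybrid where "hg \<equiv> hbvec BG"
abbreviation hmu :: hybrid where "hmu \<equiv> hbvec BMu"
abbreviation hnu :: hybrid where "hnu \<equiv> hbvec BNu"

fun hmul_table :: "hbasis \<Rightarrow> hbasis \<Rightarrow> hybrid" where
  "hmul_table BOne j = hbvec j"
| "hmul_table BG BOne = hg"
| "hmul_table BG BG = - hbvec BOne"
| "hmul_table BG BMu = hbvec BOne - hnu"
| "hmul_table BG BNu = hmu + hg"
| "hmul_table BMu BOne = hmu"
| "hmul_table BMu BG = hbvec BOne + hnu"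
| "hmul_table BMu BMu = 0"
| "hmul_table BMu BNu = - hmu"
| "hmul_table BNu BOne = hnu"
| "hmul_table BNu BG = - hmu - hg"
| "hmul_table BNu BMu = hmu"
| "hmul_table BNu BNu = hbvec BOne"

instantiation hybrid :: ring_1
begin

definition one_hybrid :: hybrid where "1 = hbvec BOne"

definition times_hybrid :: "hybrid \<Rightarrow> hybrid \<Rightarrow> hybrid" where
  "x * y = (\<Sum>i\<in>UNIV. \<Sum>j\<in>UNIV. (hcoord x i * hcoord y j) *\<^sub>K hmul_table i j)"

instance
proof
  fix x y z :: hybrid
  have coords:
    "hcoord (a * b) BOne = hcoord a BOne * hcoord b BOne - hcoord a BG * hcoord b BG
       + hcoord a BG * hcoord b BMu + hcoord a BMu * hcoord b BG + hcoord a BNu * hcoord b BNu"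
    "hcoord (a * b) BG = hcoord a BOne * hcoord b BG + hcoord a BG * hcoord b BOne
       + hcoord a BG * hcoord b BNu - hcoord a BNu * hcoord b BG"
    "hcoord (a * b) BMu = hcoord a BOne * hcoord b BMu + hcoord a BMu * hcoord b BOne
       + hcoord a BG * hcoord b BNu - hcoord a BNu * hcoord b BG
       - hcoord a BMu * hcoord b BNu + hcoord a BNu * hcoord b BMu"
    "hcoord (a * b) BNu = hcoord a BOne * hcoord b BNu + hcoord a BNu * hcoord b BOne
       - hcoord a BG * hcoord b BMu + hcoord a BMu * hcoord b BG" for a b :: hybrid
    unfolding times_hybrid_def by (simp_all add: sum_hbasis one_hybrid_def)
  show "x * y * z = x * (y * z)"
    unfolding hybrid_eq_iff all_hbasis by (simp only: coords) (simp add: algebra_simps)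
  show "1 * x = x" and "x * 1 = x"
    unfolding hybrid_eq_iff all_hbasis by (simp_all add: coords one_hybrid_def)
  show "(x + y) * z = x * z + y * z" and "x * (y + z) = x * y + x * z"
    unfolding times_hybrid_def hybrid_eq_iff by (simp_all add: sum.distrib algebra_simps)
  show "(0::hybrid) \<noteq> 1"
    unfolding one_hybrid_def hybrid_eq_iff all_hbasis by simp
qed

end

lemma hscale_mult:
  "(c *\<^sub>K x) * y = c *\<^sub>K (x * y)"  "x * (c *\<^sub>K y) = c *\<^sub>K (x * y)"
  unfolding times_hybrid_def hybrid_eq_iff
  by (auto simp: sum_distrib_left mult_ac)


section \<open>The tensor square\<close>

text \<open>
  The tensor square of the hybrid numbers is given by coordinates with respect to the basis of
  elementary tensors of basis vectors; \<open>tensor_lift\<close> evaluates a bilinear map on a tensor, which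
  is what Sweedler notation abbreviates. The universal property is proved below.
\<close>

type_synonym hybrid2 = "complex ^ (hbasis \<times> hbasis)"

definition tensor :: "hybrid \<Rightarrow> hybrid \<Rightarrow> hybrid2"  (infixr \<open>\<otimes>\<^sub>K\<close> 76) where
  "x \<otimes>\<^sub>K y = (\<chi> p. hcoord x (fst p) * hcoord y (snd p))"

definition tensor_lift ::
    "(complex \<Rightarrow> 'v \<Rightarrow> 'v) \<Rightarrow> (hybrid \<Rightarrow> hybrid \<Rightarrow> 'v) \<Rightarrow> hybrid2 \<Rightarrow> 'v::ab_group_add" where
  "tensor_lift smul \<beta> t = (\<Sum>p\<in>UNIV. smul (t $ p) (\<beta> (hbvec (fst p)) (hbvec (snd p))))"

definition hbilinear ::
    "(complex \<Rightarrow> 'v \<Rightarrow> 'v) \<Rightarrow> (hybrid \<Rightarrow> hybrid \<Rightarrow> 'v::ab_group_add) \<Rightarrow> bool" where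
  "hbilinear smul \<beta> \<longleftrightarrow>
     (\<forall>x. Vector_Spaces.linear hscale smul (\<lambda>y. \<beta> x y)) \<and>
     (\<forall>y. Vector_Spaces.linear hscale smul (\<lambda>x. \<beta> x y))"

lemma hbilinear_tensor: "hbilinear (*s) (\<otimes>\<^sub>K)"
  unfolding hbilinear_def tensor_def
  by (auto simp: Vector_Spaces.linear_iff hybrid.vector_space_axioms vec.vector_space_axioms
        vec_eq_iff algebra_simps)

lemma linear_tensor_lift:
  assumes "vector_space smul"
  shows "Vector_Spaces.linear (*s) smul (tensor_lift smul \<beta>)"
proof -
  interpret V: vector_space smul by fact
  show ?thesis
    by (simp add: Vector_Spaces.linear_iff vec.vector_space_axioms V.vector_space_axioms
        tensor_lift_def V.scale_left_distrib sum.distrib V.scale_sum_right)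
qed

lemma tensor_lift_tensor:
  assumes "vector_space smul" and "hbilinear smul \<beta>"
  shows "tensor_lift smul \<beta> (x \<otimes>\<^sub>K y) = \<beta> x y"
proof -
  interpret V: vector_space smul by fact
  interpret vector_space_pair hscale smul ..
  have L: "Vector_Spaces.linear hscale smul (\<lambda>y. \<beta> x y)"
          "Vector_Spaces.linear hscale smul (\<lambda>x. \<beta> x y)" for x y
    using assms(2) by (auto simp: hbilinear_def)
  have "\<beta> x y = \<beta> (\<Sum>i\<in>UNIV. hcoord x i *\<^sub>K hbvec i) y"
    by (simp only: hybrid_expansion[of x, symmetric])
  also have "\<dots> = (\<Sum>i\<in>UNIV. smul (hcoord x i) (\<beta> (hbvec i) y))"
    by (simp only: linear_sum[OF L(2)] linear_scale[OF L(2)])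
  also have "\<dots> = (\<Sum>i\<in>UNIV. smul (hcoord x i)
      (\<beta> (hbvec i) (\<Sum>j\<in>UNIV. hcoord y j *\<^sub>K hbvec j)))"
    by (simp only: hybrid_expansion[of y, symmetric])
  also have "\<dots> = (\<Sum>i\<in>UNIV. \<Sum>j\<in>UNIV.
      smul (hcoord x i * hcoord y j) (\<beta> (hbvec i) (hbvec j)))"
    by (simp only: linear_sum[OF L(1)] linear_scale[OF L(1)] V.scale_sum_right V.scale_scale)
  also have "\<dots> = tensor_lift smul \<beta> (x \<otimes>\<^sub>K y)"
    unfolding tensor_lift_def tensor_def
    by (simp add: sum.cartesian_product case_prod_unfold flip: UNIV_Times_UNIV)
  finally show ?thesis ..
qed

lemma hybrid2_expansion: "t = (\<Sum>p\<in>UNIV. t $ p *s (hbvec (fst p) \<otimes>\<^sub>K hbvec (snd p)))"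
proof -
  have "t $ q = (\<Sum>p\<in>UNIV. if p = q then t $ p else 0)" for q
    by simp
  also have "(\<Sum>p\<in>UNIV. if p = q then t $ p else 0) =
      (\<Sum>p\<in>UNIV. t $ p *s (hbvec (fst p) \<otimes>\<^sub>K hbvec (snd p))) $ q" for q
    by (auto simp: tensor_def prod_eq_iff intro!: sum.cong)
  finally show ?thesis
    unfolding vec_eq_iff by (rule allI)
qed

theorem tensor_universal:
  assumes "vector_space smul" and "hbilinear smul \<beta>"
  shows "\<exists>!F. Vector_Spaces.linear (*s) smul F \<and> (\<forall>x y. F (x \<otimes>\<^sub>K y) = \<beta> x y)"
proof (rule ex1I)
  show "Vector_Spaces.linear (*s) smul (tensor_lift smul \<beta>) \<and>
      (\<forall>x y. tensor_lift smul \<beta> (x \<otimes>\<^sub>K y) = \<beta> x y)"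
    using linear_tensor_lift tensor_lift_tensor assms by blast
next
  fix F assume F: "Vector_Spaces.linear (*s) smul F \<and> (\<forall>x y. F (x \<otimes>\<^sub>K y) = \<beta> x y)"
  interpret V: vector_space smul by fact
  interpret vector_space_pair "(*s) :: complex \<Rightarrow> hybrid2 \<Rightarrow> hybrid2" smul ..
  have "F t = tensor_lift smul \<beta> t" for t
  proof -
    have "F t = F (\<Sum>p\<in>UNIV. t $ p *s (hbvec (fst p) \<otimes>\<^sub>K hbvec (snd p)))"
      by (simp only: hybrid2_expansion[of t, symmetric])
    also have "\<dots> = tensor_lift smul \<beta> t"
      using F by (simp add: linear_sum linear_scale tensor_lift_def)
    finally show ?thesis .
  qed
  then show "F = tensor_lift smul \<beta>" ..
qed


section \<open>The weak Hopf algebra structure\<close>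

fun comult_table :: "complex \<Rightarrow> hbasis \<Rightarrow> hybrid2" where
  "comult_table b BOne =
     (1/2) *s (1 \<otimes>\<^sub>K 1) - (1/2) *s (hmu \<otimes>\<^sub>K hmu) - (\<i>/2) *s (hnu \<otimes>\<^sub>K hmu)
     - (\<i>/2) *s (hmu \<otimes>\<^sub>K hnu) + (1/2) *s (hnu \<otimes>\<^sub>K hnu)"
| "comult_table b BG =
     - ((1/2) *s (hmu \<otimes>\<^sub>K 1)) - (\<i>/2) *s (hnu \<otimes>\<^sub>K 1) + b *s (hg \<otimes>\<^sub>K hg)
     + b *s (hmu \<otimes>\<^sub>K hg) + (\<i> * b) *s (hnu \<otimes>\<^sub>K hg) - (1/2) *s (1 \<otimes>\<^sub>K hmu)
     + b *s (hg \<otimes>\<^sub>K hmu) + b *s (hmu \<otimes>\<^sub>K hmu) + (\<i> * b) *s (hnu \<otimes>\<^sub>K hmu)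
     - (\<i>/2) *s (1 \<otimes>\<^sub>K hnu) + (\<i> * b) *s (hg \<otimes>\<^sub>K hnu) + (\<i> * b) *s (hmu \<otimes>\<^sub>K hnu)
     - b *s (hnu \<otimes>\<^sub>K hnu)"
| "comult_table b BMu = (1 / (2 * b)) *s (hmu \<otimes>\<^sub>K hmu)"
| "comult_table b BNu =
     - ((\<i>/2) *s (hmu \<otimes>\<^sub>K 1)) + (1/2) *s (hnu \<otimes>\<^sub>K 1) - (\<i>/2) *s (1 \<otimes>\<^sub>K hmu)
     + (\<i> / (2 * b)) *s (hmu \<otimes>\<^sub>K hmu) + (1/2) *s (1 \<otimes>\<^sub>K hnu)"

definition comult :: "complex \<Rightarrow> hybrid \<Rightarrow> hybrid2" where
  "comult b x = (\<Sum>i\<in>UNIV. hcoord x i *s comult_table b i)"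

fun counit_table :: "complex \<Rightarrow> hbasis \<Rightarrow> complex" where
  "counit_table b BOne = 2"
| "counit_table b BG = 1 / b"
| "counit_table b BMu = 2 * b"
| "counit_table b BNu = 2 * \<i> * b"

definition counit :: "complex \<Rightarrow> hybrid \<Rightarrow> complex" where
  "counit b x = (\<Sum>i\<in>UNIV. hcoord x i * counit_table b i)"

fun antipode_table :: "complex \<Rightarrow> hbasis \<Rightarrow> hybrid" where
  "antipode_table b BOne = 1"
| "antipode_table b BG = (- 1 + 1 / (2 * b\<^sup>2)) *\<^sub>K hmu - \<i> *\<^sub>K hnu"
| "antipode_table b BMu =
     (2 * b\<^sup>2) *\<^sub>K hg + (2 * b\<^sup>2) *\<^sub>K hmu + (2 * \<i> * b\<^sup>2) *\<^sub>K hnu"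
| "antipode_table b BNu =
     (2 * \<i> * b\<^sup>2) *\<^sub>K hg - (\<i> - 2 * \<i> * b\<^sup>2) *\<^sub>K hmu + (1 - 2 * b\<^sup>2) *\<^sub>K hnu"

definition antipode :: "complex \<Rightarrow> hybrid \<Rightarrow> hybrid" where
  "antipode b x = (\<Sum>i\<in>UNIV. hcoord x i *\<^sub>K antipode_table b i)"

text \<open>
  In Sweedler notation the first tensor factor of \<open>\<Delta>(1)\<close> is \<open>x\<close> and the second is \<open>y\<close>.
\<close>

definition eps_t :: "complex \<Rightarrow> hybrid \<Rightarrow> hybrid" where
  "eps_t b h = tensor_lift hscale (\<lambda>x y. counit b (x * h) *\<^sub>K y) (comult b 1)"

definition eps_s :: "complex \<Rightarrow> hybrid \<Rightarrow> hybrid" where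
  "eps_s b h = tensor_lift hscale (\<lambda>x y. counit b (h * y) *\<^sub>K x) (comult b 1)"

definition target_algebra :: "complex \<Rightarrow> hybrid set" where
  "target_algebra b = range (eps_t b)"

definition source_algebra :: "complex \<Rightarrow> hybrid set" where
  "source_algebra b = range (eps_s b)"

end

(* With w = nu - i mu one has Delta(1) = (1 (x) 1 + w (x) w)/2, so eps_t(h) and eps_s(h) are
   combinations of 1 and w with coefficients eps(h)/2 and eps(wh)/2, respectively eps(hw)/2.
   Since w^2 = 1, eps(1) = 2 and eps(w) = 0, both maps fix every combination of 1 and w. *)

theory Submission
  imports Defs
begin

abbreviation hw :: hybrid where "hw \<equiv> hnu - \<i> *\<^sub>K hmu"

text \<open>Since (-\<i>)(-\<i>) = -1, expanding \<open>hw \<otimes>\<^sub>K hw\<close> produces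
  exactly the four terms in \<open>hmu\<close> and \<open>hnu\<close> of the table entry.\<close>

lemma comult_one: "comult b 1 = (1/2) *s (1 \<otimes>\<^sub>K 1) + (1/2) *s (hw \<otimes>\<^sub>K hw)"
proof -
  have "comult b 1 = comult_table b BOne"
    by (simp add: comult_def one_hybrid_def sum_hbasis)
  then show ?thesis
    by (auto simp: vec_eq_iff tensor_def algebra_simps)
qed

text \<open>\<nu> squares to 1, \<mu> squares to 0, and the cross terms cancel because \<mu>\<nu> =
  -\<nu>\<mu>.\<close>

lemma hw_square: "hw * hw = 1"
  unfolding hybrid_eq_iff all_hbasis
  by (simp add: times_hybrid_def one_hybrid_def sum_hbasis)

lemma counit_add: "counit b (x + y) = counit b x + counit b y"
  by (simp add: counit_def sum.distrib algebra_simps)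

lemma counit_scale: "counit b (c *\<^sub>K x) = c * counit b x"
  by (simp add: counit_def sum_distrib_left mult.assoc)

lemma counit_one: "counit b 1 = 2"
  by (simp add: counit_def one_hybrid_def sum_hbasis)

text \<open>The values 2\<i>b at \<nu> and 2b at \<mu> cancel: 2\<i>b - \<i>(2b) = 0.\<close>

lemma counit_hw: "counit b hw = 0"
  by (simp add: counit_def sum_hbasis)

text \<open>Linearity of the lift reduces a Sweedler sum over \<Delta>(1) to the two elementary
  tensors of \<open>comult_one\<close>.\<close>

lemma tensor_lift_comult_one:
  assumes "hbilinear hscale \<beta>"
  shows "tensor_lift hscale \<beta> (comult b 1) = (1/2) *\<^sub>K \<beta> 1 1 + (1/2) *\<^sub>K \<beta> hw hw"
proof -
  have "Vector_Spaces.linear (*s) hscale (tensor_lift hscale \<beta>)"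
    by (rule linear_tensor_lift) (rule hybrid.vector_space_axioms)
  then show ?thesis
    using tensor_lift_tensor[OF hybrid.vector_space_axioms assms]
    by (simp only: comult_one Vector_Spaces.linear_iff)
qed

lemma eps_t_eq: "eps_t b h = (counit b h / 2) *\<^sub>K 1 + (counit b (hw * h) / 2) *\<^sub>K hw"
proof -
  have "hbilinear hscale (\<lambda>x y. counit b (x * h) *\<^sub>K y)"
    by (simp add: hbilinear_def Vector_Spaces.linear_iff hybrid.vector_space_axioms
        hybrid.scale_right_distrib hybrid.scale_left_distrib distrib_right
        hscale_mult counit_add counit_scale mult.commute)
  then show ?thesis
    by (simp add: eps_t_def tensor_lift_comult_one)
qed

lemma eps_s_eq: "eps_s b h = (counit b h / 2) *\<^sub>K 1 + (counit b (h * hw) / 2) *\<^sub>K hw"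
proof -
  have "hbilinear hscale (\<lambda>x y. counit b (h * y) *\<^sub>K x)"
    by (simp add: hbilinear_def Vector_Spaces.linear_iff hybrid.vector_space_axioms
        hybrid.scale_right_distrib hybrid.scale_left_distrib distrib_left
        hscale_mult counit_add counit_scale mult.commute)
  then show ?thesis
    by (simp add: eps_s_def tensor_lift_comult_one)
qed

text \<open>Half the counit reads off the coefficient of 1, as \<open>hw\<close> lies in its
  kernel.\<close>

lemma counit_combination: "counit b (c *\<^sub>K 1 + d *\<^sub>K hw) = 2 * c"
  by (simp only: counit_add counit_scale counit_one counit_hw) simp

lemma eps_t_combination: "eps_t b (c *\<^sub>K 1 + d *\<^sub>K hw) = c *\<^sub>K 1 + d *\<^sub>K hw"
proof -
  \<comment> \<open>Multiplying by \<open>hw\<close> swaps the two coefficients, so the counit of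
    the product recovers d just as the counit of the element itself recovers c.\<close>
  have "hw * (c *\<^sub>K 1 + d *\<^sub>K hw) = d *\<^sub>K 1 + c *\<^sub>K hw"
    by (simp only: distrib_left hscale_mult hw_square mult_1_right add.commute)
  then show ?thesis
    by (simp only: eps_t_eq counit_combination) simp
qed

lemma eps_s_combination: "eps_s b (c *\<^sub>K 1 + d *\<^sub>K hw) = c *\<^sub>K 1 + d *\<^sub>K hw"
proof -
  have "(c *\<^sub>K 1 + d *\<^sub>K hw) * hw = d *\<^sub>K 1 + c *\<^sub>K hw"
    by (simp only: distrib_right hscale_mult hw_square mult_1_left add.commute)
  then show ?thesis
    by (simp only: eps_s_eq counit_combination) simp
qed

lemma span_one_hw: "hybrid.span {1, hw} = {c *\<^sub>K 1 + d *\<^sub>K hw | c d. True}"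
proof -
  \<comment> \<open>\<open>span_insert\<close> describes membership through x - k1 lying in the span
    of \<open>hw\<close>; this solves for x.\<close>
  have "x - k *\<^sub>K 1 = d *\<^sub>K hw \<longleftrightarrow> x = k *\<^sub>K 1 + d *\<^sub>K hw" for x k d
    by (simp only: diff_eq_eq add.commute)
  then show ?thesis
    unfolding hybrid.span_insert[of 1] hybrid.span_singleton by blast
qed

text \<open>Values in the span bound the range from above; each point of the span is its own image,
  which gives the other inclusion.\<close>

lemma range_eq_span_one_hw:
  assumes "\<And>h. \<exists>c d. f h = c *\<^sub>K 1 + d *\<^sub>K hw"
    and "\<And>c d. f (c *\<^sub>K 1 + d *\<^sub>K hw) = c *\<^sub>K 1 + d *\<^sub>K hw"
  shows "range f = hybrid.span {1, hw}"
proof -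
  have "c *\<^sub>K 1 + d *\<^sub>K hw \<in> range f" for c d
    using assms(2) by (metis rangeI)
  then show ?thesis
    unfolding span_one_hw using assms(1) by blast
qed

theorem mainTheorem2:
  fixes b :: complex
  assumes "b \<noteq> 0"
  shows "target_algebra b = source_algebra b \<and>
         target_algebra b = hybrid.span {1, hnu - \<i> *\<^sub>K hmu} \<and>
         source_algebra b = hybrid.span {1, hnu - \<i> *\<^sub>K hmu}"
proof -
  have "target_algebra b = hybrid.span {1, hw}"
    unfolding target_algebra_def
    by (rule range_eq_span_one_hw) (use eps_t_eq eps_t_combination in blast)+
  moreover have "source_algebra b = hybrid.span {1, hw}"
    unfolding source_algebra_def
    by (rule range_eq_span_one_hw) (use eps_s_eq eps_s_combination in blast)+
  ultimately show ?thesis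
    by simp
qed

end
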